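(* Let $\mathcal{A}\in\mathbb{C}^{I_1\times\cdots\times I_M\times J_1\times\cdots\times J_N}$, and let $\mathcal{M}\in\mathbb{C}^{I_1\times\cdots\times I_M\times I_1\times\cdots\times I_M}$ and $\mathcal{N}\in\mathbb{C}^{J_1\times\cdots\times J_N\times J_1\times\cdots\times J_N}$ be Hermitian positive definite tensors. Then $$(\mathcal{A}^{\dagger}_{\mathcal{M}\mathcal{N}}*_M\mathcal{A})^{\#}_{\mathcal{N}\mathcal{N}}=\mathcal{A}^{\dagger}_{\mathcal{M}\mathcal{N}}*_M\mathcal{A}.$$
   Context: For $\mathcal{A}\in\mathbb{C}^{I_1\times\cdots\times I_M\times J_1\times\cdots\times J_N}$ and $\mathcal{B}\in\mathbb{C}^{J_1\times\cdots\times J_N\times K_1\times\cdots\times K_L}$ the Einstein product $*_N$ (contracting $N$ indices) is $(\mathcal{A}*_N\mathcal{B})_{i_1\cdots i_Mk_1\cdots k_L}=\sum_{j_1,\dots,j_N}a_{i_1\cdots i_Mj_1\cdots j_N}b_{j_1\cdots j_Nk_1\cdots k_L}$; $*_M,*_K$ are defined likewise. The conjugate transpose is $(\mathcal{A}^H)_{j_1\cdots j_Ni_1\cdots i_M}=\overline{a_{i_1\cdots i_Mj_1\cdots j_N}}$. In $\mathbb{C}^{I_1\times\cdots\times I_K\times I_1\times\cdots\times I_K}$: the identity tensor $\mathcal{I}$ has entries $\prod_k\delta_{i_kj_k}$; $\mathcal{U}$ is unitary if $\mathcal{U}*_K\mathcal{U}^H=\mathcal{U}^H*_K\mathcal{U}=\mathcal{I}$;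 $\mathcal{D}$ is diagonal if $d_{i_1\cdots i_Kj_1\cdots j_K}=0$ whenever $(i_1,\dots,i_K)\ne(j_1,\dots,j_K)$; $\mathcal{P}$ is Hermitian positive definite if $\mathcal{P}=\mathcal{U}*_K\mathcal{D}*_K\mathcal{U}^H$ with $\mathcal{U}$ unitary and $\mathcal{D}$ diagonal with positive diagonal entries; $\mathcal{P}^{-1}$ is the inverse with respect to $*_K$. For any $\mathcal{A}\in\mathbb{C}^{I_1\times\cdots\times I_M\times J_1\times\cdots\times J_N}$ and Hermitian positive definite $\mathcal{S}\in\mathbb{C}^{I_1\times\cdots\times I_M\times I_1\times\cdots\times I_M}$, $\mathcal{T}\in\mathbb{C}^{J_1\times\cdots\times J_N\times J_1\times\cdots\times J_N}$: the weighted conjugate transpose is $\mathcal{A}^{\#}_{\mathcal{S}\mathcal{T}}=\mathcal{T}^{-1}*_N\mathcal{A}^H*_M\mathcal{S}$, and the weighted Moore--Penrose inverse $\mathcal{A}^{\dagger}_{\mathcal{S}\mathcal{T}}$ is the unique $\mathcal{X}\in\mathbb{C}^{J_1\times\cdots\times J_N\times I_1\times\cdots\times I_M}$ satisfying $\mathcal{A}*_N\mathcal{X}*_M\mathcal{A}=\mathcal{A}$, $\mathcal{X}*_M\mathcal{A}*_N\mathcal{X}=\mathcal{X}$, $(\mathcal{S}*_M\mathcal{A}*_N\mathcal{X})^H=\mathcal{S}*_M\mathcal{A}*_N\mathcal{X}$, $(\mathcal{T}*_N\mathcal{X}*_M\mathcal{A})^H=\mathcal{T}*_N\mathcal{X}*_M\mathcal{A}$.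 *)

theory Defs
  imports Complex_Main
begin

text \<open>
  A complex tensor carries the list of its mode dimensions. A multi-index is a list of natural
  numbers, counted from 0 in every mode. Entries at lists that are not valid multi-indices
  are 0, so that equality of tensors is equality of dimensions and of all proper entries.
\<close>

definition multi_indices :: "nat list \<Rightarrow> nat list set" where
  "multi_indices ds = {i. list_all2 (<) i ds}"

typedef tensor = "{(ds, f :: nat list \<Rightarrow> complex). \<forall>i. i \<notin> multi_indices ds \<longrightarrow> f i = 0}"
  by (rule exI[of _ "([], \<lambda>_. 0)"]) simp

definition dims :: "tensor \<Rightarrow> nat list" where
  "dims A = fst (Rep_tensor A)"

definition entry :: "tensor \<Rightarrow> nat list \<Rightarrow> complex" where
  "entry A = snd (Rep_tensor A)"

definition tensor :: "nat list \<Rightarrow> (nat list \<Rightarrow> complex) \<Rightarrow> tensor" where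
  "tensor ds f = Abs_tensor (ds, \<lambda>i. if i \<in> multi_indices ds then f i else 0)"

lemma Rep_tensor_tensor:
  "Rep_tensor (tensor ds f) = (ds, \<lambda>i. if i \<in> multi_indices ds then f i else 0)"
  unfolding tensor_def by (rule Abs_tensor_inverse) simp

lemma dims_tensor [simp]: "dims (tensor ds f) = ds"
  by (simp add: dims_def Rep_tensor_tensor)

lemma entry_tensor [simp]: "i \<in> multi_indices ds \<Longrightarrow> entry (tensor ds f) i = f i"
  by (simp add: entry_def Rep_tensor_tensor)

lemma entry_outside: "i \<notin> multi_indices (dims A) \<Longrightarrow> entry A i = 0"
  using Rep_tensor[of A] by (auto simp: dims_def entry_def)

lemma tensor_eqI:
  assumes "dims A = dims B" and "\<And>i. i \<in> multi_indices (dims A) \<Longrightarrow> entry A i = entry B i"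
  shows "A = B"
proof -
  have "entry A i = entry B i" for i
    using assms entry_outside[of i A] entry_outside[of i B] by (cases "i \<in> multi_indices (dims A)") auto
  then have "Rep_tensor A = Rep_tensor B"
    using assms(1) by (auto simp: dims_def entry_def prod_eq_iff fun_eq_iff)
  then show ?thesis
    by (simp add: Rep_tensor_inject)
qed

lemma length_multi_indices: "i \<in> multi_indices ds \<Longrightarrow> length i = length ds"
  by (auto simp: multi_indices_def dest: list_all2_lengthD)

lemma append_multi_indices:
  "\<lbrakk>i \<in> multi_indices I; j \<in> multi_indices J\<rbrakk> \<Longrightarrow> i @ j \<in> multi_indices (I @ J)"
  by (simp add: multi_indices_def list_all2_appendI)

lemma finite_multi_indices: "finite (multi_indices ds)"
proof (induction ds)
  case Nil
  then show ?case by (simp add: multi_indices_def)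
next
  case (Cons d ds)
  have "multi_indices (d # ds) = (\<lambda>(k, i). k # i) ` ({..<d} \<times> multi_indices ds)"
    by (auto simp: multi_indices_def list_all2_Cons2)
  then show ?case using Cons by simp
qed

text \<open>
  The Einstein product contracts the last \<open>n\<close> modes of \<open>A\<close> with the first \<open>n\<close> modes of \<open>B\<close>;
  it is meant to be used only when the dimensions of these modes agree.
\<close>

definition einstein :: "tensor \<Rightarrow> nat \<Rightarrow> tensor \<Rightarrow> tensor"  ("(_ \<star>\<^bsub>_\<^esub> _)" [70, 0, 71] 70) where
  "A \<star>\<^bsub>n\<^esub> B =
    (let m = length (dims A) - n in
     tensor (take m (dims A) @ drop n (dims B))
       (\<lambda>x. \<Sum>j\<in>multi_indices (drop m (dims A)).
          entry A (take m x @ j) * entry B (j @ drop m x)))"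

lemma
  assumes "dims A = I @ J" "dims B = J @ K"
  shows dims_einstein: "dims (A \<star>\<^bsub>length J\<^esub> B) = I @ K"
    and entry_einstein: "\<lbrakk>i \<in> multi_indices I; k \<in> multi_indices K\<rbrakk> \<Longrightarrow>
      entry (A \<star>\<^bsub>length J\<^esub> B) (i @ k) =
        (\<Sum>j\<in>multi_indices J. entry A (i @ j) * entry B (j @ k))"
  using assms length_multi_indices[of i I]
  by (auto simp: einstein_def Let_def append_multi_indices)

text \<open>
  The first \<open>m\<close> modes of \<open>A\<close> are its row modes, the remaining ones its column modes; the
  argument \<open>x\<close> below lists the column indices first.
\<close>

definition conj_transpose :: "nat \<Rightarrow> tensor \<Rightarrow> tensor" where
  "conj_transpose m A =
    (let n = length (dims A) - m in
     tensor (drop m (dims A) @ take m (dims A))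
       (\<lambda>x. cnj (entry A (drop n x @ take n x))))"

lemma
  assumes "dims A = I @ J"
  shows dims_conj_transpose: "dims (conj_transpose (length I) A) = J @ I"
    and entry_conj_transpose: "\<lbrakk>i \<in> multi_indices I; j \<in> multi_indices J\<rbrakk> \<Longrightarrow>
      entry (conj_transpose (length I) A) (j @ i) = cnj (entry A (i @ j))"
  using assms length_multi_indices[of j J]
  by (auto simp: conj_transpose_def Let_def append_multi_indices)

definition id_tensor :: "nat list \<Rightarrow> tensor" where
  "id_tensor I = tensor (I @ I)
     (\<lambda>x. \<Prod>k<length I. if x ! k = x ! (length I + k) then 1 else 0)"

definition unitary_tensor :: "nat list \<Rightarrow> tensor \<Rightarrow> bool" where
  "unitary_tensor I U \<longleftrightarrow> dims U = I @ I \<and>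
     U \<star>\<^bsub>length I\<^esub> conj_transpose (length I) U = id_tensor I \<and>
     conj_transpose (length I) U \<star>\<^bsub>length I\<^esub> U = id_tensor I"

definition diagonal_tensor :: "nat list \<Rightarrow> tensor \<Rightarrow> bool" where
  "diagonal_tensor I D \<longleftrightarrow> dims D = I @ I \<and>
     (\<forall>i\<in>multi_indices I. \<forall>j\<in>multi_indices I. i \<noteq> j \<longrightarrow> entry D (i @ j) = 0)"

definition hermitian_pos_def :: "nat list \<Rightarrow> tensor \<Rightarrow> bool" where
  "hermitian_pos_def I P \<longleftrightarrow> dims P = I @ I \<and>
     (\<exists>U D. unitary_tensor I U \<and> diagonal_tensor I D \<and>
        (\<forall>i\<in>multi_indices I. entry D (i @ i) \<in> \<real> \<and> Re (entry D (i @ i)) > 0) \<and>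
        P = U \<star>\<^bsub>length I\<^esub> D \<star>\<^bsub>length I\<^esub> conj_transpose (length I) U)"

definition inv_tensor :: "nat list \<Rightarrow> tensor \<Rightarrow> tensor" where
  "inv_tensor I P = (THE Q. dims Q = I @ I \<and>
     P \<star>\<^bsub>length I\<^esub> Q = id_tensor I \<and> Q \<star>\<^bsub>length I\<^esub> P = id_tensor I)"

lemma entry_id_tensor:
  assumes "i \<in> multi_indices I" "j \<in> multi_indices I"
  shows "entry (id_tensor I) (i @ j) = (if i = j then 1 else 0)"
proof -
  have "entry (id_tensor I) (i @ j) = (\<Prod>k<length I. if i ! k = j ! k then 1 else 0)"
    using assms length_multi_indices[OF assms(1)]
    by (auto simp: id_tensor_def append_multi_indices nth_append intro!: prod.cong)
  also have "\<dots> = (if i = j then 1 else 0)"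
    using length_multi_indices[OF assms(1)] length_multi_indices[OF assms(2)]
    by (auto simp: list_eq_iff_nth_eq prod_zero_iff)
  finally show ?thesis .
qed

text \<open>In the weighted notions, \<open>A\<close> has row modes \<open>I\<close> and column modes \<open>J\<close>.\<close>

definition weighted_conj_transpose ::
    "nat list \<Rightarrow> nat list \<Rightarrow> tensor \<Rightarrow> tensor \<Rightarrow> tensor \<Rightarrow> tensor" where
  "weighted_conj_transpose I J S T A =
     inv_tensor J T \<star>\<^bsub>length J\<^esub> conj_transpose (length I) A \<star>\<^bsub>length I\<^esub> S"

definition is_weighted_MP_inverse ::
    "nat list \<Rightarrow> nat list \<Rightarrow> tensor \<Rightarrow> tensor \<Rightarrow> tensor \<Rightarrow> tensor \<Rightarrow> bool" where
  "is_weighted_MP_inverse I J S T A X \<longleftrightarrow>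
     (let m = length I; n = length J in
      dims X = J @ I \<and>
      A \<star>\<^bsub>n\<^esub> X \<star>\<^bsub>m\<^esub> A = A \<and>
      X \<star>\<^bsub>m\<^esub> A \<star>\<^bsub>n\<^esub> X = X \<and>
      conj_transpose m (S \<star>\<^bsub>m\<^esub> A \<star>\<^bsub>n\<^esub> X) = S \<star>\<^bsub>m\<^esub> A \<star>\<^bsub>n\<^esub> X \<and>
      conj_transpose n (T \<star>\<^bsub>n\<^esub> X \<star>\<^bsub>m\<^esub> A) = T \<star>\<^bsub>n\<^esub> X \<star>\<^bsub>m\<^esub> A)"

definition weighted_MP_inverse ::
    "nat list \<Rightarrow> nat list \<Rightarrow> tensor \<Rightarrow> tensor \<Rightarrow> tensor \<Rightarrow> tensor" where
  "weighted_MP_inverse I J S T A = (THE X. is_weighted_MP_inverse I J S T A X)"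

end

theory Submission
  imports Defs "HOL-Library.Function_Algebras"
begin

text \<open>
  Once the weighted Moore--Penrose inverse \<open>X\<close> is known to exist, the fourth defining equation
  reads \<open>(X A)\<^sup>H N = N (X A)\<close>, since \<open>N\<close> is Hermitian; multiplying by \<open>N\<^sup>-\<^sup>1\<close> from the left is the
  claim. Existence is the real content: a tensor with row modes \<open>I\<close> and column modes \<open>J\<close> is a
  matrix indexed by the multi-indices, and for matrices a generalized inverse is built from an
  inner inverse of \<open>A\<^sup>H M A\<close>.
\<close>

section \<open>Algebra of finitely supported complex matrices\<close>

text \<open>
  Matrices are total functions and the index set of the contraction is an argument of the product,
  so associativity needs no side conditions; only the identity laws need \<open>supported\<close>.
\<close>

type_synonym 'a mat = "'a \<Rightarrow> 'a \<Rightarrow> complex"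

definition mat_mult :: "'a mat \<Rightarrow> 'a set \<Rightarrow> 'a mat \<Rightarrow> 'a mat"  ("(_ \<odot>\<^bsub>_\<^esub> _)" [70, 0, 71] 70) where
  "A \<odot>\<^bsub>J\<^esub> B = (\<lambda>i k. \<Sum>j\<in>J. A i j * B j k)"

definition adj :: "'a mat \<Rightarrow> 'a mat" where
  "adj A = (\<lambda>j i. cnj (A i j))"

text \<open>Cut off outside \<open>I\<close>, because a product of matrices supported on
  \<open>I\<close> vanishes there and could not otherwise equal the identity as a function.\<close>

definition id_mat :: "'a set \<Rightarrow> 'a mat" where
  "id_mat I = (\<lambda>i j. if i \<in> I \<and> i = j then 1 else 0)"

definition supported :: "'a set \<Rightarrow> 'a set \<Rightarrow> 'a mat \<Rightarrow> bool" where
  "supported I J A \<longleftrightarrow> (\<forall>i j. i \<notin> I \<or> j \<notin> J \<longrightarrow> A i j = 0)"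

lemma mat_mult_assoc: "A \<odot>\<^bsub>J\<^esub> B \<odot>\<^bsub>K\<^esub> C = A \<odot>\<^bsub>J\<^esub> (B \<odot>\<^bsub>K\<^esub> C)"
proof (intro ext)
  fix i l
  have "(A \<odot>\<^bsub>J\<^esub> B \<odot>\<^bsub>K\<^esub> C) i l = (\<Sum>k\<in>K. \<Sum>j\<in>J. A i j * (B j k * C k l))"
    by (simp add: mat_mult_def sum_distrib_right mult.assoc)
  also have "\<dots> = (\<Sum>j\<in>J. \<Sum>k\<in>K. A i j * (B j k * C k l))"
    by (rule sum.swap)
  also have "\<dots> = (A \<odot>\<^bsub>J\<^esub> (B \<odot>\<^bsub>K\<^esub> C)) i l"
    by (simp add: mat_mult_def sum_distrib_left)
  finally show "(A \<odot>\<^bsub>J\<^esub> B \<odot>\<^bsub>K\<^esub> C) i l = (A \<odot>\<^bsub>J\<^esub> (B \<odot>\<^bsub>K\<^esub> C)) i l" .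
qed

lemma mat_mult_diff: "A \<odot>\<^bsub>J\<^esub> (B - C) = A \<odot>\<^bsub>J\<^esub> B - A \<odot>\<^bsub>J\<^esub> C"
  by (simp add: mat_mult_def fun_eq_iff right_diff_distrib sum_subtractf)

lemma diff_mat_mult: "(A - B) \<odot>\<^bsub>J\<^esub> C = A \<odot>\<^bsub>J\<^esub> C - B \<odot>\<^bsub>J\<^esub> C"
  by (simp add: mat_mult_def fun_eq_iff left_diff_distrib sum_subtractf)

lemma mat_mult_zero [simp]: "A \<odot>\<^bsub>J\<^esub> 0 = 0"
  by (simp add: mat_mult_def fun_eq_iff)

lemma adj_adj [simp]: "adj (adj A) = A"
  by (simp add: adj_def)

lemma adj_mult: "adj (A \<odot>\<^bsub>J\<^esub> B) = adj B \<odot>\<^bsub>J\<^esub> adj A"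
  by (simp add: adj_def mat_mult_def fun_eq_iff mult.commute)

lemma adj_diff: "adj (A - B) = adj A - adj B"
  by (simp add: adj_def fun_eq_iff)

lemma adj_id [simp]: "adj (id_mat I) = id_mat I"
  by (auto simp: adj_def id_mat_def fun_eq_iff)

lemma supported_adj: "supported I J A \<Longrightarrow> supported J I (adj A)"
  by (auto simp: supported_def adj_def)

lemma supported_mult: "\<lbrakk>supported I J A; supported J K B\<rbrakk> \<Longrightarrow> supported I K (A \<odot>\<^bsub>J\<^esub> B)"
  by (auto simp: supported_def mat_mult_def)

lemma id_mult:
  assumes "finite I" "supported I J A"
  shows "id_mat I \<odot>\<^bsub>I\<^esub> A = A"
proof (intro ext)
  fix i k
  have "(id_mat I \<odot>\<^bsub>I\<^esub> A) i k = (\<Sum>j\<in>I. if i = j then A j k else 0)"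
    unfolding mat_mult_def id_mat_def by (intro sum.cong) auto
  also have "\<dots> = A i k"
    using assms by (auto simp: supported_def)
  finally show "(id_mat I \<odot>\<^bsub>I\<^esub> A) i k = A i k" .
qed

lemma mult_id:
  assumes "finite J" "supported I J A"
  shows "A \<odot>\<^bsub>J\<^esub> id_mat J = A"
proof -
  have "adj (A \<odot>\<^bsub>J\<^esub> id_mat J) = adj A"
    by (simp add: adj_mult id_mult[OF assms(1) supported_adj[OF assms(2)]])
  then show ?thesis
    by (metis adj_adj)
qed

section \<open>Inner inverses from linear algebra\<close>

text \<open>A linear map has a linear right inverse on its range. Applied to the map
  \<open>ap\<close> of \<open>A\<close>, this gives a map \<open>g\<close> with
  \<open>ap (g (ap v)) = ap v\<close>, and \<open>G\<close> is the matrix of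
  \<open>g\<close>.\<close>

lemma inner_inverse_exists:
  assumes "finite I" "finite J" "supported I J A"
  obtains G where "supported J I G" "A \<odot>\<^bsub>J\<^esub> G \<odot>\<^bsub>I\<^esub> A = A"
proof -
  define scale where "scale = (\<lambda>(c::complex) (f::'a \<Rightarrow> complex) x. c * f x)"
  interpret vs: vector_space scale
    by unfold_locales (simp_all add: scale_def fun_eq_iff algebra_simps)
  interpret vp: vector_space_pair scale scale ..
  define ap where "ap = (\<lambda>v i. \<Sum>j\<in>J. A i j * v j)"
  have "Vector_Spaces.linear scale scale ap"
    by unfold_locales
      (simp_all add: ap_def scale_def fun_eq_iff algebra_simps sum.distrib sum_distrib_left)
  from vp.linear_exists_right_inverse_on[OF this vs.subspace_UNIV]
  obtain g where g: "Vector_Spaces.linear scale scale g" and inv: "\<And>v. ap (g (ap v)) = ap v"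
    by auto
  interpret g: Vector_Spaces.linear scale scale g by (rule g)
  define e where "e = (\<lambda>i j::'a. if i = j then 1 else 0 :: complex)"
  \<comment> \<open>Column \<open>i\<close> of \<open>G\<close> is \<open>g (e i)\<close>. Cutting
    it down to \<open>J\<close> is harmless, since \<open>ap\<close> reads only the coordinates in
    \<open>J\<close>.\<close>
  define G where "G = (\<lambda>j i. if j \<in> J \<and> i \<in> I then g (e i) j else 0)"
  have ap_e: "ap (e l) = (\<lambda>i. A i l)" for l
  proof
    fix i
    have "ap (e l) i = (\<Sum>j\<in>J. if l = j then A i j else 0)"
      unfolding ap_def e_def by (intro sum.cong) auto
    then show "ap (e l) i = A i l"
      using assms by (auto simp: supported_def)
  qed
  \<comment> \<open>The function space may be infinite-dimensional, and \<open>g\<close> commutes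
    only with finite sums. The columns of \<open>A\<close> are finite combinations of the
    \<open>e k\<close> because \<open>I\<close> is finite and \<open>A\<close> vanishes outside
    it.\<close>
  have col: "(\<lambda>i. A i l) = (\<Sum>k\<in>I. scale (A k l) (e k))" for l
  proof
    fix i
    have "(\<Sum>k\<in>I. scale (A k l) (e k)) i = (\<Sum>k\<in>I. scale (A k l) (e k) i)"
      using assms(1) by induction auto
    also have "\<dots> = (\<Sum>k\<in>I. if k = i then A k l else 0)"
      unfolding scale_def e_def by (intro sum.cong) auto
    also have "\<dots> = A i l"
      using assms by (auto simp: supported_def)
    finally show "A i l = (\<Sum>k\<in>I. scale (A k l) (e k)) i" ..
  qed
  have gcol: "g (\<lambda>i. A i l) j = (G \<odot>\<^bsub>I\<^esub> A) j l" if "j \<in> J" for l j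
  proof -
    have "g (\<lambda>i. A i l) = (\<Sum>k\<in>I. scale (A k l) (g (e k)))"
      unfolding col by (simp add: g.sum g.scale)
    moreover have "(\<Sum>k\<in>I. scale (A k l) (g (e k))) j = (\<Sum>k\<in>I. scale (A k l) (g (e k)) j)"
      using assms(1) by induction auto
    ultimately show ?thesis
      using that by (simp add: mat_mult_def scale_def G_def mult.commute)
  qed
  have "(A \<odot>\<^bsub>J\<^esub> (G \<odot>\<^bsub>I\<^esub> A)) i l = A i l" for i l
  proof -
    have "(A \<odot>\<^bsub>J\<^esub> (G \<odot>\<^bsub>I\<^esub> A)) i l = ap (g (ap (e l))) i"
      unfolding ap_e by (simp add: ap_def gcol mat_mult_def[of A])
    then show ?thesis
      using inv[of "e l"] by (simp add: ap_e)
  qed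
  then have "A \<odot>\<^bsub>J\<^esub> G \<odot>\<^bsub>I\<^esub> A = A"
    by (simp add: mat_mult_assoc fun_eq_iff)
  moreover have "supported J I G"
    by (auto simp: supported_def G_def)
  ultimately show thesis
    using that by blast
qed

section \<open>Inverse and positive definite matrices\<close>

definition inverse_mats :: "'a set \<Rightarrow> 'a mat \<Rightarrow> 'a mat \<Rightarrow> bool" where
  "inverse_mats I P Q \<longleftrightarrow> supported I I P \<and> supported I I Q \<and>
     P \<odot>\<^bsub>I\<^esub> Q = id_mat I \<and> Q \<odot>\<^bsub>I\<^esub> P = id_mat I"

lemma inverse_mats_sym: "inverse_mats I P Q \<Longrightarrow> inverse_mats I Q P"
  by (auto simp: inverse_mats_def)

lemma inverse_mats_cancel:
  assumes "finite I" "inverse_mats I P Q" "supported I J A"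
  shows "Q \<odot>\<^bsub>I\<^esub> (P \<odot>\<^bsub>I\<^esub> A) = A"
  using assms by (metis id_mult inverse_mats_def mat_mult_assoc)

lemma inverse_mats_cancel_right:
  assumes "finite I" "inverse_mats I P Q" "supported J I A"
  shows "A \<odot>\<^bsub>I\<^esub> P \<odot>\<^bsub>I\<^esub> Q = A"
  using assms by (metis mult_id inverse_mats_def mat_mult_assoc)

text \<open>Collects the consequences of positive definiteness used below. The last clause tests
  definiteness on matrices \<open>W\<close> rather than on vectors, since it is applied directly to
  a difference such as \<open>A Y - A\<close>.\<close>

definition pos_def_mat :: "'a set \<Rightarrow> 'a mat \<Rightarrow> bool" where
  "pos_def_mat I P \<longleftrightarrow> supported I I P \<and> adj P = P \<and> (\<exists>Q. inverse_mats I P Q) \<and>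
     (\<forall>J W. supported I J W \<longrightarrow> adj W \<odot>\<^bsub>I\<^esub> P \<odot>\<^bsub>I\<^esub> W = 0 \<longrightarrow> W = 0)"

text \<open>The inverse is \<open>U E (adj U)\<close> with \<open>E\<close> the inverse of
  \<open>D\<close>. For definiteness put \<open>V = adj U W\<close>: the form becomes
  \<open>adj V D V\<close>, and its diagonal entries are sums of squares weighted by the positive
  \<open>d j\<close>.\<close>

lemma pos_def_mat_spectral:
  assumes "finite I" and U: "inverse_mats I U (adj U)"
    and D: "supported I I D" "\<And>i j. \<lbrakk>i \<in> I; j \<in> I; i \<noteq> j\<rbrakk> \<Longrightarrow> D i j = 0"
    and pos: "\<And>i. i \<in> I \<Longrightarrow> D i i \<in> \<real> \<and> Re (D i i) > 0"
  shows "pos_def_mat I (U \<odot>\<^bsub>I\<^esub> D \<odot>\<^bsub>I\<^esub> adj U)"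
proof -
  let ?P = "U \<odot>\<^bsub>I\<^esub> D \<odot>\<^bsub>I\<^esub> adj U"
  note [simp] = \<open>finite I\<close>
  define E where "E = (\<lambda>i j. if i \<in> I \<and> i = j then inverse (D i i) else 0)"
  define d where "d = (\<lambda>i. Re (D i i))"
  have D_eq: "D i j = (if i \<in> I \<and> i = j then of_real (d i) else 0)" for i j
    using D pos[of i] unfolding supported_def d_def by (metis of_real_Re)
  have d_pos: "d i > 0" if "i \<in> I" for i
    using pos[OF that] by (simp add: d_def)
  have supp: "supported I I U" "supported I I (adj U)" "supported I I E"
    using U by (auto simp: inverse_mats_def supported_def E_def)
  have DE: "inverse_mats I D E"
  proof -
    have *: "F \<odot>\<^bsub>I\<^esub> F' = id_mat I"
      if F: "\<And>i j. F i j = (if i \<in> I \<and> i = j then f i else 0)"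
        and F': "\<And>i j. F' i j = (if i \<in> I \<and> i = j then f' i else 0)"
        and ff: "\<And>i. i \<in> I \<Longrightarrow> f i * f' i = 1" for F F' :: "'a mat" and f f'
    proof (intro ext)
      fix i k
      have "(F \<odot>\<^bsub>I\<^esub> F') i k = (\<Sum>j\<in>I. if j = i then (if i = k then 1 else 0) else 0)"
        unfolding mat_mult_def by (intro sum.cong) (auto simp: F F' ff)
      then show "(F \<odot>\<^bsub>I\<^esub> F') i k = id_mat I i k"
        by (auto simp: id_mat_def)
    qed
    have nz: "D i i \<noteq> 0" if "i \<in> I" for i
      using d_pos[OF that] that by (simp add: D_eq)
    have "D \<odot>\<^bsub>I\<^esub> E = id_mat I"
      by (rule *[where f = "\<lambda>i. D i i" and f' = "\<lambda>i. inverse (D i i)"])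
        (use nz in \<open>auto simp: E_def D_eq\<close>)
    moreover have "E \<odot>\<^bsub>I\<^esub> D = id_mat I"
      by (rule *[where f' = "\<lambda>i. D i i" and f = "\<lambda>i. inverse (D i i)"])
        (use nz in \<open>auto simp: E_def D_eq\<close>)
    ultimately show ?thesis
      using D supp by (simp add: inverse_mats_def)
  qed
  have suppP: "supported I I ?P"
    using D supp by (simp add: supported_mult)
  \<comment> \<open>Stated for an arbitrary inverse pair, so that it yields both orders of the
    product, from \<open>D, E\<close> and from \<open>E, D\<close>.\<close>
  have prod: "(U \<odot>\<^bsub>I\<^esub> F \<odot>\<^bsub>I\<^esub> adj U) \<odot>\<^bsub>I\<^esub> (U \<odot>\<^bsub>I\<^esub> F' \<odot>\<^bsub>I\<^esub> adj U) = id_mat I"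
    if "inverse_mats I F F'" for F F'
  proof -
    have s: "supported I I F" "supported I I F'"
      using that by (auto simp: inverse_mats_def)
    have "(U \<odot>\<^bsub>I\<^esub> F \<odot>\<^bsub>I\<^esub> adj U) \<odot>\<^bsub>I\<^esub> (U \<odot>\<^bsub>I\<^esub> F' \<odot>\<^bsub>I\<^esub> adj U) =
        U \<odot>\<^bsub>I\<^esub> (F \<odot>\<^bsub>I\<^esub> (adj U \<odot>\<^bsub>I\<^esub> (U \<odot>\<^bsub>I\<^esub> (F' \<odot>\<^bsub>I\<^esub> adj U))))"
      by (simp add: mat_mult_assoc)
    also have "adj U \<odot>\<^bsub>I\<^esub> (U \<odot>\<^bsub>I\<^esub> (F' \<odot>\<^bsub>I\<^esub> adj U)) = F' \<odot>\<^bsub>I\<^esub> adj U"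
      by (rule inverse_mats_cancel[OF _ U]) (auto intro!: supported_mult s supp)
    also have "F \<odot>\<^bsub>I\<^esub> (F' \<odot>\<^bsub>I\<^esub> adj U) = adj U"
      by (rule inverse_mats_cancel[OF _ inverse_mats_sym[OF that] supp(2)]) simp
    finally show ?thesis
      using U by (simp add: inverse_mats_def)
  qed
  have "inverse_mats I ?P (U \<odot>\<^bsub>I\<^esub> E \<odot>\<^bsub>I\<^esub> adj U)"
    unfolding inverse_mats_def
    using prod[OF DE] prod[OF inverse_mats_sym[OF DE]] D(1) supp by (simp add: supported_mult)
  moreover have "adj D = D"
    by (auto simp: adj_def D_eq fun_eq_iff)
  then have "adj ?P = ?P"
    by (simp add: adj_mult mat_mult_assoc)
  moreover have "W = 0" if W: "supported I J W" "adj W \<odot>\<^bsub>I\<^esub> ?P \<odot>\<^bsub>I\<^esub> W = 0" for J W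
  proof -
    define V where "V = adj U \<odot>\<^bsub>I\<^esub> W"
    have V0: "adj V \<odot>\<^bsub>I\<^esub> (D \<odot>\<^bsub>I\<^esub> V) = 0"
      using W(2) by (simp add: V_def adj_mult mat_mult_assoc)
    have "V i k = 0" if "i \<in> I" for i k
    proof -
      have DV: "(D \<odot>\<^bsub>I\<^esub> V) j k = of_real (d j) * V j k" if "j \<in> I" for j
      proof -
        have "(D \<odot>\<^bsub>I\<^esub> V) j k = (\<Sum>l\<in>I. if l = j then of_real (d j) * V j k else 0)"
          unfolding mat_mult_def using that by (intro sum.cong) (auto simp: D_eq)
        then show ?thesis using that by simp
      qed
      \<comment> \<open>The diagonal entry at \<open>k\<close> already suffices: it is a vanishing
        sum of nonnegative reals, so every term of column \<open>k\<close> vanishes.\<close>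
      have "0 = (adj V \<odot>\<^bsub>I\<^esub> (D \<odot>\<^bsub>I\<^esub> V)) k k"
        by (simp add: V0)
      also have "\<dots> = (\<Sum>j\<in>I. of_real (d j * (cmod (V j k))\<^sup>2))"
        unfolding mat_mult_def[of "adj V"]
      proof (intro sum.cong)
        fix j assume "j \<in> I"
        then show "adj V k j * (D \<odot>\<^bsub>I\<^esub> V) j k = of_real (d j * (cmod (V j k))\<^sup>2)"
          unfolding of_real_mult complex_norm_square by (simp add: DV adj_def)
      qed simp
      finally have "(\<Sum>j\<in>I. d j * (cmod (V j k))\<^sup>2) = 0"
        by (metis of_real_eq_0_iff of_real_sum)
      moreover have "\<forall>j\<in>I. d j * (cmod (V j k))\<^sup>2 \<ge> 0"
        using d_pos by (simp add: less_imp_le)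
      ultimately have "d i * (cmod (V i k))\<^sup>2 = 0"
        using that by (simp add: sum_nonneg_eq_0_iff)
      then show ?thesis
        using d_pos[OF that] by simp
    qed
    moreover have "supported I J V"
      unfolding V_def by (rule supported_mult[OF supp(2) W(1)])
    ultimately have "V = 0"
      by (auto simp: fun_eq_iff supported_def)
    moreover have "U \<odot>\<^bsub>I\<^esub> V = W"
      unfolding V_def by (rule inverse_mats_cancel[OF _ inverse_mats_sym[OF U] W(1)]) simp
    ultimately show ?thesis
      by simp
  qed
  ultimately show ?thesis
    using suppP unfolding pos_def_mat_def by blast
qed

text \<open>As \<open>Q\<close> is Hermitian and \<open>P Q W = W\<close>, the form of
  \<open>Q\<close> at \<open>W\<close> is the form of \<open>P\<close> at \<open>Q W\<close>. This
  makes the inverse of a weight available as a weight.\<close>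

lemma pos_def_mat_inverse:
  assumes "finite I" "pos_def_mat I P" "inverse_mats I P Q"
  shows "pos_def_mat I Q"
proof -
  have P: "supported I I P" "adj P = P" and Q: "supported I I Q"
    using assms by (auto simp: pos_def_mat_def inverse_mats_def)
  \<comment> \<open>The adjoint of \<open>P Q = id\<close> shows that \<open>adj Q\<close> is a left
    inverse of \<open>P\<close>, and a left inverse must equal \<open>Q\<close>.\<close>
  have "adj Q \<odot>\<^bsub>I\<^esub> P = id_mat I"
    using assms(3) P(2) by (metis adj_id adj_mult inverse_mats_def)
  then have adjQ: "adj Q = Q"
    using inverse_mats_cancel_right[OF assms(1,3) supported_adj[OF Q]] id_mult[OF assms(1) Q] by simp
  moreover have "W = 0" if W: "supported I J W" "adj W \<odot>\<^bsub>I\<^esub> Q \<odot>\<^bsub>I\<^esub> W = 0" for J W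
  proof -
    have QW: "supported I J (Q \<odot>\<^bsub>I\<^esub> W)"
      by (rule supported_mult[OF Q W(1)])
    have PQW: "P \<odot>\<^bsub>I\<^esub> (Q \<odot>\<^bsub>I\<^esub> W) = W"
      by (rule inverse_mats_cancel[OF assms(1) inverse_mats_sym[OF assms(3)] W(1)])
    have "adj (Q \<odot>\<^bsub>I\<^esub> W) \<odot>\<^bsub>I\<^esub> P \<odot>\<^bsub>I\<^esub> (Q \<odot>\<^bsub>I\<^esub> W) = 0"
      using W(2) by (simp add: adj_mult adjQ mat_mult_assoc PQW)
    then have "Q \<odot>\<^bsub>I\<^esub> W = 0"
      using assms(2) QW unfolding pos_def_mat_def by blast
    then show ?thesis
      using PQW by simp
  qed
  ultimately show ?thesis
    using inverse_mats_sym[OF assms(3)] Q unfolding pos_def_mat_def by blast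
qed

section \<open>Existence of the weighted Moore-Penrose inverse\<close>

text \<open>The first and third of the four defining equations. For positive definite
  \<open>S\<close> they say that \<open>A X\<close> is the \<open>S\<close>-orthogonal projection
  onto the column space of \<open>A\<close>.\<close>

definition weighted_13_inverse :: "'a set \<Rightarrow> 'a set \<Rightarrow> 'a mat \<Rightarrow> 'a mat \<Rightarrow> 'a mat \<Rightarrow> bool" where
  "weighted_13_inverse I J S A X \<longleftrightarrow> supported J I X \<and> A \<odot>\<^bsub>J\<^esub> X \<odot>\<^bsub>I\<^esub> A = A \<and>
     adj (S \<odot>\<^bsub>I\<^esub> A \<odot>\<^bsub>J\<^esub> X) = S \<odot>\<^bsub>I\<^esub> A \<odot>\<^bsub>J\<^esub> X"

text \<open>
  With \<open>G\<close> an inner inverse of \<open>H = A\<^sup>H S A\<close>, definiteness of \<open>S\<close> lets one cancel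
  \<open>A\<^sup>H S\<close> in \<open>H G H = H\<close>, and \<open>G A\<^sup>H S\<close> is the desired inverse.
\<close>

lemma weighted_13_inverse_exists:
  assumes fin: "finite I" "finite J" and A: "supported I J A" and S: "pos_def_mat I S"
  shows "\<exists>X. weighted_13_inverse I J S A X"
proof -
  define H where "H = adj A \<odot>\<^bsub>I\<^esub> S \<odot>\<^bsub>I\<^esub> A"
  have S': "supported I I S" "adj S = S"
    using S by (auto simp: pos_def_mat_def)
  have suppH: "supported J J H"
    unfolding H_def by (intro supported_mult supported_adj A S')
  have adjH: "adj H = H"
    by (simp add: H_def adj_mult S' mat_mult_assoc)
  obtain G where G: "supported J J G" "H \<odot>\<^bsub>J\<^esub> G \<odot>\<^bsub>J\<^esub> H = H"
    using inner_inverse_exists[OF fin(2) fin(2) suppH] .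
  \<comment> \<open>For \<open>W = A Y - A\<close>, the equation \<open>H Y = H\<close> says that
    \<open>adj A S W = 0\<close>. Since \<open>adj W\<close> is a left multiple of
    \<open>adj A\<close>, also \<open>adj W S W = 0\<close>.\<close>
  have cancel: "A \<odot>\<^bsub>J\<^esub> Y = A" if Y: "supported J J Y" "H \<odot>\<^bsub>J\<^esub> Y = H" for Y
  proof -
    define W where "W = A \<odot>\<^bsub>J\<^esub> Y - A"
    have "supported I J (A \<odot>\<^bsub>J\<^esub> Y)"
      by (rule supported_mult[OF A Y(1)])
    then have suppW: "supported I J W"
      using A by (simp add: W_def supported_def)
    have 0: "adj A \<odot>\<^bsub>I\<^esub> (S \<odot>\<^bsub>I\<^esub> W) = 0"
      using Y(2) by (simp add: W_def H_def mat_mult_diff mat_mult_assoc)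
    have "adj W = adj Y \<odot>\<^bsub>J\<^esub> adj A - adj A"
      by (simp add: W_def adj_diff adj_mult)
    then have "adj W \<odot>\<^bsub>I\<^esub> S \<odot>\<^bsub>I\<^esub> W = 0"
      by (simp add: diff_mat_mult mat_mult_assoc 0)
    then have "W = 0"
      using S suppW unfolding pos_def_mat_def by blast
    then show ?thesis
      by (simp add: W_def)
  qed
  have AGH: "A \<odot>\<^bsub>J\<^esub> (G \<odot>\<^bsub>J\<^esub> H) = A"
    by (rule cancel) (use G suppH in \<open>simp_all add: supported_mult mat_mult_assoc\<close>)
  \<comment> \<open>\<open>G\<close> need not be Hermitian, but \<open>H\<close> is, so
    \<open>adj G\<close> is an inner inverse of \<open>H\<close> as well. Comparing the two gives
    the symmetry of \<open>A G (adj A)\<close>, on which the third equation rests.\<close>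
  have "H \<odot>\<^bsub>J\<^esub> (adj G \<odot>\<^bsub>J\<^esub> H) = H"
    using arg_cong[OF G(2), of adj] by (simp add: adj_mult adjH)
  then have AGH': "A \<odot>\<^bsub>J\<^esub> (adj G \<odot>\<^bsub>J\<^esub> H) = A"
    by (intro cancel) (simp_all add: G suppH supported_mult supported_adj)
  have HGA: "H \<odot>\<^bsub>J\<^esub> (G \<odot>\<^bsub>J\<^esub> adj A) = adj A"
    using arg_cong[OF AGH', of adj] by (simp add: adj_mult adjH mat_mult_assoc)
  have "A \<odot>\<^bsub>J\<^esub> (G \<odot>\<^bsub>J\<^esub> adj A) = A \<odot>\<^bsub>J\<^esub> (adj G \<odot>\<^bsub>J\<^esub> H) \<odot>\<^bsub>J\<^esub> (G \<odot>\<^bsub>J\<^esub> adj A)"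
    by (simp add: AGH')
  also have "\<dots> = A \<odot>\<^bsub>J\<^esub> (adj G \<odot>\<^bsub>J\<^esub> adj A)"
    by (simp add: mat_mult_assoc HGA)
  finally have sym: "A \<odot>\<^bsub>J\<^esub> (G \<odot>\<^bsub>J\<^esub> adj A) = A \<odot>\<^bsub>J\<^esub> (adj G \<odot>\<^bsub>J\<^esub> adj A)" .
  let ?X = "G \<odot>\<^bsub>J\<^esub> adj A \<odot>\<^bsub>I\<^esub> S"
  have "supported J I ?X"
    by (intro supported_mult supported_adj A S' G)
  moreover have "A \<odot>\<^bsub>J\<^esub> ?X \<odot>\<^bsub>I\<^esub> A = A"
    using AGH by (simp add: H_def mat_mult_assoc)
  moreover have "S \<odot>\<^bsub>I\<^esub> A \<odot>\<^bsub>J\<^esub> ?X = S \<odot>\<^bsub>I\<^esub> (A \<odot>\<^bsub>J\<^esub> (G \<odot>\<^bsub>J\<^esub> adj A)) \<odot>\<^bsub>I\<^esub> S"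
    by (simp add: mat_mult_assoc)
  moreover have "adj (S \<odot>\<^bsub>I\<^esub> (A \<odot>\<^bsub>J\<^esub> (G \<odot>\<^bsub>J\<^esub> adj A)) \<odot>\<^bsub>I\<^esub> S) =
      S \<odot>\<^bsub>I\<^esub> (A \<odot>\<^bsub>J\<^esub> (adj G \<odot>\<^bsub>J\<^esub> adj A)) \<odot>\<^bsub>I\<^esub> S"
    by (simp add: adj_mult S' mat_mult_assoc)
  ultimately show ?thesis
    unfolding weighted_13_inverse_def using sym by metis
qed

definition weighted_MP_mat ::
    "'a set \<Rightarrow> 'a set \<Rightarrow> 'a mat \<Rightarrow> 'a mat \<Rightarrow> 'a mat \<Rightarrow> 'a mat \<Rightarrow> bool" where
  "weighted_MP_mat I J S T A X \<longleftrightarrow> supported J I X \<and>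
     A \<odot>\<^bsub>J\<^esub> X \<odot>\<^bsub>I\<^esub> A = A \<and> X \<odot>\<^bsub>I\<^esub> A \<odot>\<^bsub>J\<^esub> X = X \<and>
     adj (S \<odot>\<^bsub>I\<^esub> A \<odot>\<^bsub>J\<^esub> X) = S \<odot>\<^bsub>I\<^esub> A \<odot>\<^bsub>J\<^esub> X \<and>
     adj (T \<odot>\<^bsub>J\<^esub> X \<odot>\<^bsub>I\<^esub> A) = T \<odot>\<^bsub>J\<^esub> X \<odot>\<^bsub>I\<^esub> A"

text \<open>
  The proof takes a matrix satisfying equations (1) and (4), the adjoint of a (1,3)-inverse
  of \<open>A\<^sup>H\<close> with weight \<open>T\<^sup>-\<^sup>1\<close>; Urquhart's formula then combines it with a (1,3)-inverse of \<open>A\<close>.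
\<close>

lemma weighted_MP_mat_exists:
  assumes fin: "finite I" "finite J" and A: "supported I J A"
    and S: "pos_def_mat I S" and T: "pos_def_mat J T"
  shows "\<exists>X. weighted_MP_mat I J S T A X"
proof -
  obtain X1 where "weighted_13_inverse I J S A X1"
    using weighted_13_inverse_exists[OF fin A S] by blast
  then have X1: "supported J I X1" "A \<odot>\<^bsub>J\<^esub> (X1 \<odot>\<^bsub>I\<^esub> A) = A"
      "adj (S \<odot>\<^bsub>I\<^esub> (A \<odot>\<^bsub>J\<^esub> X1)) = S \<odot>\<^bsub>I\<^esub> (A \<odot>\<^bsub>J\<^esub> X1)"
    by (simp_all add: weighted_13_inverse_def mat_mult_assoc)
  obtain R where R: "inverse_mats J T R"
    using T by (auto simp: pos_def_mat_def)
  have pdR: "pos_def_mat J R"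
    by (rule pos_def_mat_inverse[OF fin(2) T R])
  have T': "supported J J T" "adj T = T" and R': "supported J J R" "adj R = R"
    using T pdR by (auto simp: pos_def_mat_def)
  \<comment> \<open>The third equation for \<open>adj A\<close> with weight \<open>R\<close> says
    that \<open>R (adj A) Y\<close> is Hermitian. Its adjoint is \<open>X2 A R\<close> with
    \<open>X2 = adj Y\<close>.\<close>
  obtain Y where "weighted_13_inverse J I R (adj A) Y"
    using weighted_13_inverse_exists[OF fin(2,1) supported_adj[OF A] pdR] by blast
  then have Y: "supported I J Y" "adj A \<odot>\<^bsub>I\<^esub> (Y \<odot>\<^bsub>J\<^esub> adj A) = adj A"
      "adj (R \<odot>\<^bsub>J\<^esub> (adj A \<odot>\<^bsub>I\<^esub> Y)) = R \<odot>\<^bsub>J\<^esub> (adj A \<odot>\<^bsub>I\<^esub> Y)"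
    by (simp_all add: weighted_13_inverse_def mat_mult_assoc)
  define X2 where "X2 = adj Y"
  have X2: "supported J I X2"
    unfolding X2_def by (rule supported_adj[OF Y(1)])
  have AX2A: "A \<odot>\<^bsub>J\<^esub> (X2 \<odot>\<^bsub>I\<^esub> A) = A"
    using arg_cong[OF Y(2), of adj] by (simp add: X2_def adj_mult mat_mult_assoc)
  define Q where "Q = X2 \<odot>\<^bsub>I\<^esub> A"
  have Q: "supported J J Q"
    unfolding Q_def by (rule supported_mult[OF X2 A])
  have QR: "Q \<odot>\<^bsub>J\<^esub> R = R \<odot>\<^bsub>J\<^esub> adj Q"
    using Y(3) by (simp add: Q_def X2_def adj_mult R' mat_mult_assoc)
  \<comment> \<open>Multiplying \<open>Q R = R (adj Q)\<close> by \<open>T\<close> on both sides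
    gives \<open>T Q = adj Q T\<close>, the fourth equation for \<open>X2\<close>.\<close>
  have TQ: "adj (T \<odot>\<^bsub>J\<^esub> Q) = T \<odot>\<^bsub>J\<^esub> Q"
  proof -
    have "T \<odot>\<^bsub>J\<^esub> Q = T \<odot>\<^bsub>J\<^esub> (Q \<odot>\<^bsub>J\<^esub> R \<odot>\<^bsub>J\<^esub> T)"
      using inverse_mats_cancel_right[OF fin(2) inverse_mats_sym[OF R] Q] by simp
    also have "\<dots> = T \<odot>\<^bsub>J\<^esub> (R \<odot>\<^bsub>J\<^esub> (adj Q \<odot>\<^bsub>J\<^esub> T))"
      by (simp add: QR mat_mult_assoc)
    also have "\<dots> = adj Q \<odot>\<^bsub>J\<^esub> T"
      by (rule inverse_mats_cancel[OF fin(2) inverse_mats_sym[OF R]])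
        (rule supported_mult[OF supported_adj[OF Q] T'(1)])
    finally show ?thesis
      by (simp add: adj_mult T')
  qed
  \<comment> \<open>This choice has \<open>A X = A X1\<close> and \<open>X A = X2 A\<close>, so it
    inherits the third equation from \<open>X1\<close> and the fourth from
    \<open>X2\<close>.\<close>
  let ?X = "X2 \<odot>\<^bsub>I\<^esub> (A \<odot>\<^bsub>J\<^esub> X1)"
  have AX: "A \<odot>\<^bsub>J\<^esub> ?X = A \<odot>\<^bsub>J\<^esub> X1"
    using AX2A by (metis mat_mult_assoc)
  have XA: "?X \<odot>\<^bsub>I\<^esub> A = X2 \<odot>\<^bsub>I\<^esub> A"
    using X1(2) by (simp add: mat_mult_assoc)
  have "supported J I ?X"
    by (intro supported_mult X1 X2 A)
  moreover have "A \<odot>\<^bsub>J\<^esub> ?X \<odot>\<^bsub>I\<^esub> A = A"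
    using X1(2) by (simp add: AX mat_mult_assoc)
  moreover have "?X \<odot>\<^bsub>I\<^esub> A \<odot>\<^bsub>J\<^esub> ?X = ?X"
    unfolding XA by (metis AX mat_mult_assoc)
  moreover have "S \<odot>\<^bsub>I\<^esub> A \<odot>\<^bsub>J\<^esub> ?X = S \<odot>\<^bsub>I\<^esub> (A \<odot>\<^bsub>J\<^esub> X1)"
    by (simp add: mat_mult_assoc[of S] AX)
  moreover have "T \<odot>\<^bsub>J\<^esub> ?X \<odot>\<^bsub>I\<^esub> A = T \<odot>\<^bsub>J\<^esub> Q"
    by (simp add: mat_mult_assoc[of T] XA Q_def)
  ultimately have "weighted_MP_mat I J S T A ?X"
    unfolding weighted_MP_mat_def using X1(3) TQ by simp
  then show ?thesis
    by blast
qed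

section \<open>Uniqueness of the weighted Moore-Penrose inverse\<close>

text \<open>
  The projections have the same range or the same kernel; in either case use
  \<open>S Q P = Q\<^sup>H S P = Q\<^sup>H P\<^sup>H S = (P Q)\<^sup>H S\<close>.
\<close>

lemma weighted_projection_unique:
  assumes fin: "finite I" and S: "pos_def_mat I S"
    and P: "supported I I P" "adj (S \<odot>\<^bsub>I\<^esub> P) = S \<odot>\<^bsub>I\<^esub> P"
    and Q: "supported I I Q" "adj (S \<odot>\<^bsub>I\<^esub> Q) = S \<odot>\<^bsub>I\<^esub> Q"
    and PQ: "Q \<odot>\<^bsub>I\<^esub> P = P \<and> P \<odot>\<^bsub>I\<^esub> Q = Q \<or> Q \<odot>\<^bsub>I\<^esub> P = Q \<and> P \<odot>\<^bsub>I\<^esub> Q = P"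
  shows "P = Q"
proof -
  have S': "adj S = S"
    using S by (simp add: pos_def_mat_def)
  obtain R where R: "inverse_mats I S R"
    using S by (auto simp: pos_def_mat_def)
  have P': "S \<odot>\<^bsub>I\<^esub> P = adj P \<odot>\<^bsub>I\<^esub> S" and Q': "S \<odot>\<^bsub>I\<^esub> Q = adj Q \<odot>\<^bsub>I\<^esub> S"
    using P(2) Q(2) by (simp_all add: adj_mult S')
  have "S \<odot>\<^bsub>I\<^esub> Q \<odot>\<^bsub>I\<^esub> P = adj Q \<odot>\<^bsub>I\<^esub> adj P \<odot>\<^bsub>I\<^esub> S"
    by (simp add: Q' P' mat_mult_assoc)
  then have "S \<odot>\<^bsub>I\<^esub> (Q \<odot>\<^bsub>I\<^esub> P) = adj (P \<odot>\<^bsub>I\<^esub> Q) \<odot>\<^bsub>I\<^esub> S"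
    by (simp add: adj_mult mat_mult_assoc)
  then have "S \<odot>\<^bsub>I\<^esub> P = S \<odot>\<^bsub>I\<^esub> Q"
    using PQ P' Q' by auto
  then show ?thesis
    using inverse_mats_cancel[OF fin R P(1)] inverse_mats_cancel[OF fin R Q(1)] by metis
qed

text \<open>\<open>A X\<close> and \<open>A Y\<close> are \<open>S\<close>-orthogonal projections
  with the same range, \<open>X A\<close> and \<open>Y A\<close> are \<open>T\<close>-orthogonal
  projections with the same kernel, so they agree in pairs. Then
  \<open>X = X A X = Y A X = Y A Y = Y\<close>.\<close>

lemma weighted_MP_mat_unique:
  assumes fin: "finite I" "finite J" and A: "supported I J A"
    and S: "pos_def_mat I S" and T: "pos_def_mat J T"
    and X: "weighted_MP_mat I J S T A X" and Y: "weighted_MP_mat I J S T A Y"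
  shows "X = Y"
proof -
  have X': "supported J I X" "A \<odot>\<^bsub>J\<^esub> X \<odot>\<^bsub>I\<^esub> A = A" "X \<odot>\<^bsub>I\<^esub> A \<odot>\<^bsub>J\<^esub> X = X"
    and Y': "supported J I Y" "A \<odot>\<^bsub>J\<^esub> Y \<odot>\<^bsub>I\<^esub> A = A" "Y \<odot>\<^bsub>I\<^esub> A \<odot>\<^bsub>J\<^esub> Y = Y"
    using X Y by (auto simp: weighted_MP_mat_def)
  have AX: "A \<odot>\<^bsub>J\<^esub> X = A \<odot>\<^bsub>J\<^esub> Y"
  proof (rule weighted_projection_unique[OF fin(1) S], goal_cases)
    case 5
    then show ?case
      by (metis X'(2) Y'(2) mat_mult_assoc)
  qed (use X Y A in \<open>auto simp: weighted_MP_mat_def mat_mult_assoc supported_mult\<close>)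
  have XA: "X \<odot>\<^bsub>I\<^esub> A = Y \<odot>\<^bsub>I\<^esub> A"
  proof (rule weighted_projection_unique[OF fin(2) T], goal_cases)
    case 5
    then show ?case
      by (metis X'(2) Y'(2) mat_mult_assoc)
  qed (use X Y A in \<open>auto simp: weighted_MP_mat_def mat_mult_assoc supported_mult\<close>)
  show ?thesis
    by (metis AX XA X'(3) Y'(3) mat_mult_assoc)
qed

section \<open>Translation between tensors and matrices\<close>

text \<open>Row and column multi-indices are both of type \<open>nat list\<close>, so one matrix
  type serves all shapes and the index sets keep them apart. The default 0 makes the result
  \<open>supported\<close> for every tensor.\<close>

definition to_mat :: "nat list \<Rightarrow> nat list \<Rightarrow> tensor \<Rightarrow> nat list mat" where
  "to_mat I J A =
     (\<lambda>i j. if i \<in> multi_indices I \<and> j \<in> multi_indices J then entry A (i @ j) else 0)"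

lemma supported_to_mat: "supported (multi_indices I) (multi_indices J) (to_mat I J A)"
  by (auto simp: supported_def to_mat_def)

text \<open>Every multi-index of \<open>I @ J\<close> splits into one of \<open>I\<close> and one of
  \<open>J\<close>, so no entry is lost. This turns tensor equations into matrix equations.\<close>

lemma to_mat_inject:
  assumes "dims A = I @ J" "dims B = I @ J"
  shows "to_mat I J A = to_mat I J B \<longleftrightarrow> A = B"
proof
  assume eq: "to_mat I J A = to_mat I J B"
  show "A = B"
  proof (rule tensor_eqI)
    fix x assume "x \<in> multi_indices (dims A)"
    then obtain i j where "x = i @ j" "i \<in> multi_indices I" "j \<in> multi_indices J"
      using assms(1) by (auto simp: multi_indices_def list_all2_append2)
    then show "entry A x = entry B x"
      using fun_cong[OF fun_cong[OF eq, of i], of j] by (simp add: to_mat_def)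
  qed (simp add: assms)
qed simp

text \<open>Carries matrices whose existence has been shown, such as inverses, back to
  tensors.\<close>

lemma to_mat_surj:
  assumes "supported (multi_indices I) (multi_indices J) F"
  obtains A where "dims A = I @ J" "to_mat I J A = F"
proof
  let ?A = "tensor (I @ J) (\<lambda>x. F (take (length I) x) (drop (length I) x))"
  show "dims ?A = I @ J"
    by simp
  show "to_mat I J ?A = F"
    using assms
    by (auto simp: to_mat_def supported_def fun_eq_iff append_multi_indices
        length_multi_indices)
qed

lemma to_mat_einstein:
  assumes "dims A = I @ J" "dims B = J @ K"
  shows "to_mat I K (A \<star>\<^bsub>length J\<^esub> B) = to_mat I J A \<odot>\<^bsub>multi_indices J\<^esub> to_mat J K B"
  by (auto simp: to_mat_def mat_mult_def fun_eq_iff entry_einstein[OF assms])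

lemma to_mat_conj_transpose:
  assumes "dims A = I @ J"
  shows "to_mat J I (conj_transpose (length I) A) = adj (to_mat I J A)"
  by (auto simp: to_mat_def adj_def fun_eq_iff entry_conj_transpose[OF assms])

lemma dims_id_tensor: "dims (id_tensor I) = I @ I"
  by (simp add: id_tensor_def)

lemma to_mat_id_tensor: "to_mat I I (id_tensor I) = id_mat (multi_indices I)"
  by (auto simp: to_mat_def id_mat_def fun_eq_iff entry_id_tensor)

lemma pos_def_mat_to_mat:
  assumes "hermitian_pos_def I P"
  shows "pos_def_mat (multi_indices I) (to_mat I I P)"
proof -
  obtain U D where U: "unitary_tensor I U" and D: "diagonal_tensor I D"
    and pos: "\<forall>i\<in>multi_indices I. entry D (i @ i) \<in> \<real> \<and> Re (entry D (i @ i)) > 0"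
    and P: "P = U \<star>\<^bsub>length I\<^esub> D \<star>\<^bsub>length I\<^esub> conj_transpose (length I) U"
    using assms by (auto simp: hermitian_pos_def_def)
  have dU: "dims U = I @ I" and dD: "dims D = I @ I"
    using U D by (auto simp: unitary_tensor_def diagonal_tensor_def)
  note dims = dims_conj_transpose[OF dU] dims_einstein[OF dU dD]
  have eq: "to_mat I I P =
      to_mat I I U \<odot>\<^bsub>multi_indices I\<^esub> to_mat I I D \<odot>\<^bsub>multi_indices I\<^esub> adj (to_mat I I U)"
    by (simp add: P to_mat_einstein dims dU dD to_mat_conj_transpose)
  show ?thesis
    unfolding eq
  proof (rule pos_def_mat_spectral)
    have "to_mat I I (U \<star>\<^bsub>length I\<^esub> conj_transpose (length I) U) = id_mat (multi_indices I)"
      "to_mat I I (conj_transpose (length I) U \<star>\<^bsub>length I\<^esub> U) = id_mat (multi_indices I)"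
      using U by (simp_all add: unitary_tensor_def to_mat_id_tensor)
    then show "inverse_mats (multi_indices I) (to_mat I I U) (adj (to_mat I I U))"
      by (simp add: inverse_mats_def supported_to_mat supported_adj to_mat_einstein dims dU
          to_mat_conj_transpose)
  qed (use D pos supported_to_mat[of I I D] in
      \<open>auto simp: finite_multi_indices diagonal_tensor_def to_mat_def\<close>)
qed

text \<open>\<open>inv_tensor\<close> is a definite description, so its properties require existence
  and uniqueness. Both come from the matrix inverse \<open>R\<close>: any other inverse
  \<open>Q'\<close> satisfies \<open>Q' = R P Q' = R\<close> as matrices.\<close>

lemma inv_tensor:
  assumes "hermitian_pos_def I P"
  shows "dims (inv_tensor I P) = I @ I"
    and "inverse_mats (multi_indices I) (to_mat I I P) (to_mat I I (inv_tensor I P))"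
proof -
  let ?I = "multi_indices I"
  have dP: "dims P = I @ I"
    using assms by (simp add: hermitian_pos_def_def)
  let ?inv = "\<lambda>Q. dims Q = I @ I \<and>
     P \<star>\<^bsub>length I\<^esub> Q = id_tensor I \<and> Q \<star>\<^bsub>length I\<^esub> P = id_tensor I"
  have inv_iff: "?inv Q \<longleftrightarrow> dims Q = I @ I \<and> inverse_mats ?I (to_mat I I P) (to_mat I I Q)" for Q
  proof (cases "dims Q = I @ I")
    case dQ: True
    have *: "R = id_tensor I \<longleftrightarrow> to_mat I I R = id_mat (multi_indices I)" if "dims R = I @ I" for R
      using to_mat_inject[OF that dims_id_tensor] by (simp add: to_mat_id_tensor)
    show ?thesis
      by (simp add: * inverse_mats_def supported_to_mat dP dQ to_mat_einstein dims_einstein)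
  qed simp
  obtain R where R: "inverse_mats ?I (to_mat I I P) R"
    using pos_def_mat_to_mat[OF assms] by (auto simp: pos_def_mat_def)
  then have suppR: "supported ?I ?I R"
    by (simp add: inverse_mats_def)
  then obtain Q where Q: "dims Q = I @ I" "to_mat I I Q = R"
    by (rule to_mat_surj)
  have "Q' = Q" if "?inv Q'" for Q'
  proof -
    have Q': "dims Q' = I @ I" "inverse_mats ?I (to_mat I I P) (to_mat I I Q')"
      using that unfolding inv_iff by auto
    have "to_mat I I Q' = R \<odot>\<^bsub>?I\<^esub> (to_mat I I P \<odot>\<^bsub>?I\<^esub> to_mat I I Q')"
      using inverse_mats_cancel[OF finite_multi_indices R supported_to_mat] by simp
    also have "\<dots> = R"
      using Q'(2) by (simp add: inverse_mats_def mult_id[OF finite_multi_indices suppR])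
    finally show ?thesis
      using Q Q'(1) by (metis to_mat_inject)
  qed
  moreover have "?inv Q"
    unfolding inv_iff using Q R by simp
  ultimately have "?inv (inv_tensor I P)"
    unfolding inv_tensor_def by (rule theI[of ?inv, rotated])
  then show "dims (inv_tensor I P) = I @ I"
    and "inverse_mats ?I (to_mat I I P) (to_mat I I (inv_tensor I P))"
    unfolding inv_iff by auto
qed

lemma is_weighted_MP_inverse_iff:
  assumes "dims A = I @ J" "dims S = I @ I" "dims T = J @ J"
  shows "is_weighted_MP_inverse I J S T A X \<longleftrightarrow> dims X = J @ I \<and>
    weighted_MP_mat (multi_indices I) (multi_indices J)
      (to_mat I I S) (to_mat J J T) (to_mat I J A) (to_mat J I X)"
proof (cases "dims X = J @ I")
  case dX: True
  \<comment> \<open>Positions in the fact lists: 1 to 4 are \<open>A\<close>, \<open>S\<close>,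
    \<open>T\<close>, \<open>X\<close>; 5 to 8 are \<open>A X\<close>, \<open>X A\<close>,
    \<open>S A\<close>, \<open>T X\<close>; 9 to 12 are \<open>A X A\<close>, \<open>X A X\<close>,
    \<open>S A X\<close>, \<open>T X A\<close>; 13 and 14 are the conjugate transposes of 11 and
    12.\<close>
  note d = assms dX
  note dims = d dims_einstein[OF d(1,4)] dims_einstein[OF d(4,1)]
    dims_einstein[OF d(2,1)] dims_einstein[OF d(3,4)]
  note dims' = dims dims_einstein[OF dims(5,1)] dims_einstein[OF dims(6,4)]
    dims_einstein[OF dims(7,4)] dims_einstein[OF dims(8,1)]
  note dims'' = dims' dims_conj_transpose[OF dims'(11)] dims_conj_transpose[OF dims'(12)]
  show ?thesis
    unfolding is_weighted_MP_inverse_def weighted_MP_mat_def Let_def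
      to_mat_inject[OF dims''(9,1), symmetric] to_mat_inject[OF dims''(10,4), symmetric]
      to_mat_inject[OF dims''(13,11), symmetric] to_mat_inject[OF dims''(14,12), symmetric]
      to_mat_conj_transpose[OF dims''(11)] to_mat_conj_transpose[OF dims''(12)]
      to_mat_einstein[OF dims(5,1)] to_mat_einstein[OF dims(6,4)]
      to_mat_einstein[OF dims(7,4)] to_mat_einstein[OF dims(8,1)]
      to_mat_einstein[OF d(1,4)] to_mat_einstein[OF d(4,1)]
      to_mat_einstein[OF d(2,1)] to_mat_einstein[OF d(3,4)]
    by (simp add: dX supported_to_mat)
qed (simp add: is_weighted_MP_inverse_def)

section \<open>The weighted inverse of a tensor and its projection\<close>

text \<open>Justifies the definite description: existence and uniqueness hold for matrices and pass
  to tensors, because \<open>to_mat\<close> is a bijection onto supported matrices.\<close>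

lemma is_weighted_MP_inverse_weighted_MP_inverse:
  assumes dA: "dims A = I @ J" and S: "hermitian_pos_def I S" and T: "hermitian_pos_def J T"
  shows "is_weighted_MP_inverse I J S T A (weighted_MP_inverse I J S T A)"
proof -
  have "dims S = I @ I" "dims T = J @ J"
    using S T by (auto simp: hermitian_pos_def_def)
  note iff = is_weighted_MP_inverse_iff[OF dA this]
  note facts = finite_multi_indices finite_multi_indices supported_to_mat
    pos_def_mat_to_mat[OF S] pos_def_mat_to_mat[OF T]
  obtain F where F: "weighted_MP_mat (multi_indices I) (multi_indices J)
      (to_mat I I S) (to_mat J J T) (to_mat I J A) F"
    using weighted_MP_mat_exists[OF facts] by blast
  then have "supported (multi_indices J) (multi_indices I) F"
    by (simp add: weighted_MP_mat_def)
  then obtain X where X: "dims X = J @ I" "to_mat J I X = F"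
    by (rule to_mat_surj)
  have "Y = X" if "is_weighted_MP_inverse I J S T A Y" for Y
    using that X F weighted_MP_mat_unique[OF facts F] unfolding iff
    by (metis to_mat_inject)
  moreover have "is_weighted_MP_inverse I J S T A X"
    unfolding iff using X F by simp
  ultimately show ?thesis
    unfolding weighted_MP_inverse_def by (rule theI[rotated])
qed

theorem theorem3p6:
  fixes A M N :: tensor and I J :: "nat list"
  assumes "dims A = I @ J"
    and "hermitian_pos_def I M"
    and "hermitian_pos_def J N"
  shows "weighted_conj_transpose J J N N (weighted_MP_inverse I J M N A \<star>\<^bsub>length I\<^esub> A) =
    weighted_MP_inverse I J M N A \<star>\<^bsub>length I\<^esub> A"
proof -
  let ?J = "multi_indices J"
  define P where "P = weighted_MP_inverse I J M N A \<star>\<^bsub>length I\<^esub> A"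
  let ?N = "to_mat J J N" and ?P = "to_mat J J P" and ?R = "to_mat J J (inv_tensor J N)"
  have dM: "dims M = I @ I" and dN: "dims N = J @ J"
    using assms by (auto simp: hermitian_pos_def_def)
  note MP = is_weighted_MP_inverse_weighted_MP_inverse[OF assms,
      unfolded is_weighted_MP_inverse_iff[OF assms(1) dM dN]]
  note dR = inv_tensor(1)[OF assms(3)]
  have dP: "dims P = J @ J"
    unfolding P_def using MP assms(1) by (simp add: dims_einstein)
  have "?P = to_mat J I (weighted_MP_inverse I J M N A) \<odot>\<^bsub>multi_indices I\<^esub> to_mat I J A"
    unfolding P_def using MP assms(1) by (simp add: to_mat_einstein)
  \<comment> \<open>The fourth defining equation, regrouped by associativity so that it speaks of
    the product \<open>P\<close>.\<close>
  then have "adj (?N \<odot>\<^bsub>?J\<^esub> ?P) = ?N \<odot>\<^bsub>?J\<^esub> ?P"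
    using MP by (simp add: weighted_MP_mat_def mat_mult_assoc)
  moreover have "adj ?N = ?N"
    using pos_def_mat_to_mat[OF assms(3)] by (simp add: pos_def_mat_def)
  ultimately have NP: "adj ?P \<odot>\<^bsub>?J\<^esub> ?N = ?N \<odot>\<^bsub>?J\<^esub> ?P"
    by (simp add: adj_mult)
  note dCP = dims_conj_transpose[OF dP]
  note dRCP = dims_einstein[OF dR dCP]
  have "to_mat J J (weighted_conj_transpose J J N N P) = ?R \<odot>\<^bsub>?J\<^esub> adj ?P \<odot>\<^bsub>?J\<^esub> ?N"
    unfolding weighted_conj_transpose_def
    by (simp add: to_mat_einstein[OF dRCP dN] to_mat_einstein[OF dR dCP]
        to_mat_conj_transpose[OF dP])
  also have "\<dots> = ?P"
    using inverse_mats_cancel[OF finite_multi_indices inv_tensor(2)[OF assms(3)] supported_to_mat]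
    by (simp add: mat_mult_assoc NP)
  finally have "weighted_conj_transpose J J N N P = P"
    using dims_einstein[OF dRCP dN] dP
    by (metis to_mat_inject weighted_conj_transpose_def)
  then show ?thesis
    unfolding P_def .
qed

end
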